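(* Fix $\varepsilon>0$. There is $C=C(\varepsilon)>0$ such that if $G$ is a $2n$-vertex bipartite graph and $d$ is an arbitrary positive parameter, then $G$ has property $(\varepsilon,\varepsilon,s)$ with $$ s=C\max\{\log n,\ n\,h(G,d)\}. $$
   Context: For a graph $G$, $i_t(G)$ is the number of independent sets of $G$ of size exactly $t$. A sequence $\{a_i\}_{i\ge0}$ is $s$-step monotone increasing on $[a,b]$ ($0\le a\le b$) if for all integers $a\le i\le j\le b$ with $j-i\ge s$ we have $a_i\le a_j$, and $s$-step monotone decreasing on $[a,b]$ if under the same conditions $a_i\ge a_j$. A bipartite graph $G$ on $2n$ vertices has property $(\beta,\gamma,s)$ if $\{i_t(G)\}_{t\ge0}$ is $s$-step monotone increasing on $[\beta n,(1-\gamma)n/2]$ and $s$-step monotone decreasing on $[(1+\gamma)n/2,(1-\beta)n]$. For a bipartite graph $G$ on $2n$ vertices with bipartition classes $\mathcal E,\mathcal O$ chosen so that $|\mathcal O|\ge|\mathcal E|$, and $d>0$, with $d(v)$ the degree of $v$, $$ h(G,d)=\frac1d+\frac{|\{v\in\mathcal E: d(v)<d\}|}{n}+\frac{1}{dn}\sum_{v\in\mathcal O}(d(v)-d)\mathbf 1_{\{d(v)\ge d\}}+\frac{|\mathcal O|-|\mathcal E|}{n}. $$ $\log=\log_2$. *)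

theory Defs
  imports Complex_Main "HOL-Library.Ramsey"
begin

text \<open>A finite simple graph is given by its vertex set \<open>V\<close> and its set \<open>E\<close> of edges, each edge
  being a two-element subset of \<open>V\<close>.\<close>

definition simple_graph :: "'a set \<Rightarrow> 'a set set \<Rightarrow> bool" where
  "simple_graph V E \<longleftrightarrow> finite V \<and> E \<subseteq> [V]\<^bsup>2\<^esup>"

definition deg :: "'a set set \<Rightarrow> 'a \<Rightarrow> nat" where
  "deg E v = card {e \<in> E. v \<in> e}"

definition bipartition :: "'a set \<Rightarrow> 'a set set \<Rightarrow> 'a set \<Rightarrow> 'a set \<Rightarrow> bool" where
  "bipartition V E \<E> \<O> \<longleftrightarrow>
     \<E> \<union> \<O> = V \<and> \<E> \<inter> \<O> = {} \<and> (\<forall>e\<in>E. \<exists>u\<in>\<E>. \<exists>v\<in>\<O>. e = {u, v})"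

definition indep_count :: "'a set \<Rightarrow> 'a set set \<Rightarrow> nat \<Rightarrow> nat" where
  "indep_count V E t = card {I. I \<subseteq> V \<and> indep I E \<and> card I = t}"

text \<open>If \<open>b < a\<close> the following two conditions hold vacuously.\<close>

definition step_increasing_on :: "real \<Rightarrow> real \<Rightarrow> real \<Rightarrow> (nat \<Rightarrow> 'b::order) \<Rightarrow> bool" where
  "step_increasing_on s a b f \<longleftrightarrow>
     (\<forall>i j. a \<le> real i \<and> i \<le> j \<and> real j \<le> b \<and> real j - real i \<ge> s \<longrightarrow> f i \<le> f j)"

definition step_decreasing_on :: "real \<Rightarrow> real \<Rightarrow> real \<Rightarrow> (nat \<Rightarrow> 'b::order) \<Rightarrow> bool" where
  "step_decreasing_on s a b f \<longleftrightarrow>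
     (\<forall>i j. a \<le> real i \<and> i \<le> j \<and> real j \<le> b \<and> real j - real i \<ge> s \<longrightarrow> f i \<ge> f j)"

text \<open>In the next two definitions \<open>n\<close> is half the number of vertices.\<close>

definition has_property ::
    "nat \<Rightarrow> 'a set \<Rightarrow> 'a set set \<Rightarrow> real \<Rightarrow> real \<Rightarrow> real \<Rightarrow> bool" where
  "has_property n V E \<beta> \<gamma> s \<longleftrightarrow>
     step_increasing_on s (\<beta> * real n) ((1 - \<gamma>) * real n / 2) (indep_count V E) \<and>
     step_decreasing_on s ((1 + \<gamma>) * real n / 2) ((1 - \<beta>) * real n) (indep_count V E)"

text \<open>The bipartition of a disconnected graph is not unique, so the classes are arguments of
  \<open>h\<close>; \<open>\<O>\<close> is meant to be the class that is not smaller.\<close>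

definition h :: "nat \<Rightarrow> 'a set set \<Rightarrow> 'a set \<Rightarrow> 'a set \<Rightarrow> real \<Rightarrow> real" where
  "h n E \<E> \<O> d =
     1 / d
     + real (card {v \<in> \<E>. real (deg E v) < d}) / real n
     + 1 / (d * real n) * (\<Sum>v\<in>\<O>. (real (deg E v) - d) * of_bool (real (deg E v) \<ge> d))
     + (real (card \<O>) - real (card \<E>)) / real n"

end

theory Submission
  imports Defs "HOL-Analysis.Convex"
begin

text \<open>
  An independent set is a set \<open>X \<subseteq> \<E>\<close> together with a set of vertices of \<open>\<O>\<close> that have no neighbour in
  \<open>X\<close>, so the independence polynomial at \<open>l\<close> is a sum over \<open>X\<close> of a product of functions of
  \<open>X \<inter> N w\<close>, \<open>w \<in> \<O>\<close>. Put \<open>k = \<lceil>d\<rceil>\<close> and delete edges until every vertex of \<open>\<E>\<close> has degree exactly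
  \<open>k\<close> or, if its degree was below \<open>d\<close>, degree \<open>0\<close>. Hoelder's inequality with exponent \<open>k\<close> in each
  coordinate (Finner's inequality) then decouples the vertices of \<open>\<O>\<close>, and the
  polynomial is at most \<open>(1 + l) ^ n * exp (K * n * h)\<close>, where \<open>K\<close> depends
  only on \<open>l\<close>. Choosing \<open>l = t / (n - t)\<close>, where \<open>t\<close> is the mode of
  the binomial distribution with success probability \<open>t / n\<close>, the number of independent \<open>t\<close>-sets is
  at most \<open>(n + 1) * exp (K * n * h)\<close> times \<open>n choose t\<close>; it is at least \<open>n choose t\<close> because of the
  subsets of \<open>\<O>\<close>. In the given ranges consecutive binomial coefficients differ by a factor of at least
  \<open>1 + \<epsilon>\<close>, so \<open>s\<close> steps outweigh the error factor.
\<close>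

section \<open>Hoelder's inequality on a two-point space\<close>

lemma real_root_prod:
  assumes "0 < k"
  shows "root k (\<Prod>i\<in>S. f i) = (\<Prod>i\<in>S. root k (f i))"
  by (induction S rule: infinite_finite_induct) (use assms in \<open>auto simp: real_root_mult\<close>)

lemma prod_root_le_mean:
  fixes x :: "'i \<Rightarrow> real"
  assumes S: "finite S" "S \<noteq> {}" and x: "\<And>i. i \<in> S \<Longrightarrow> 0 \<le> x i"
  shows "(\<Prod>i\<in>S. root (card S) (x i)) \<le> (\<Sum>i\<in>S. x i) / card S"
proof -
  have pos: "0 < card S" using S by (simp add: card_gt_0_iff)
  have "0 \<le> (\<Prod>i\<in>S. x i)" using x by (simp add: prod_nonneg)
  \<comment> \<open>A vanishing product is split off because the conversion from \<open>root\<close>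
    to \<open>powr\<close> is for positive arguments; at 0 both sides are 0.\<close>
  then have "root (card S) (\<Prod>i\<in>S. x i) = (\<Prod>i\<in>S. x i) powr (1 / card S)"
    using pos by (cases "(\<Prod>i\<in>S. x i) = 0") (auto simp: root_powr_inverse)
  then show ?thesis
    using arith_geom_mean[of S x] S x pos by (simp add: real_root_prod sum_divide_distrib)
qed

text \<open>This is Hoelder's inequality for a two-point space with equal exponents. Dividing by the
  right-hand side turns the factors into roots of \<open>a i / (a i + b i)\<close> and
  \<open>b i / (a i + b i)\<close>. By the AM-GM inequality each normalised product is at most the
  mean of its ratios, and the two means add up to 1. If some \<open>a i + b i\<close> vanishes,
  every product contains a zero factor.\<close>

lemma prod_root_superadditive:
  fixes a b :: "'i \<Rightarrow> real"
  assumes S: "finite S" "S \<noteq> {}"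
    and ab: "\<And>i. i \<in> S \<Longrightarrow> 0 \<le> a i" "\<And>i. i \<in> S \<Longrightarrow> 0 \<le> b i"
  shows "(\<Prod>i\<in>S. root (card S) (a i)) + (\<Prod>i\<in>S. root (card S) (b i))
           \<le> (\<Prod>i\<in>S. root (card S) (a i + b i))"
proof (cases "\<forall>i\<in>S. 0 < a i + b i")
  case True
  let ?k = "card S" and ?c = "\<lambda>i. a i + b i"
  have pos: "0 < ?k" using S by (simp add: card_gt_0_iff)
  have split: "(\<Prod>i\<in>S. root ?k (f i))
                 = (\<Prod>i\<in>S. root ?k (?c i)) * (\<Prod>i\<in>S. root ?k (f i / ?c i))" for f
  proof -
    have "root ?k (f i) = root ?k (?c i) * root ?k (f i / ?c i)" if "i \<in> S" for i
    proof -
      have "f i = ?c i * (f i / ?c i)" using True that by force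
      then show ?thesis by (metis real_root_mult)
    qed
    then show ?thesis by (simp add: prod.distrib[symmetric])
  qed
  have "(\<Prod>i\<in>S. root ?k (a i / ?c i)) + (\<Prod>i\<in>S. root ?k (b i / ?c i))
          \<le> (\<Sum>i\<in>S. a i / ?c i) / ?k + (\<Sum>i\<in>S. b i / ?c i) / ?k"
    by (intro add_mono prod_root_le_mean S) (use ab True in \<open>auto simp: less_imp_le\<close>)
  also have "\<dots> = (\<Sum>i\<in>S. 1) / ?k"
    unfolding add_divide_distrib[symmetric] sum.distrib[symmetric]
    by (intro arg_cong[where f = "\<lambda>t. t / ?k"] sum.cong)
       (use True in \<open>auto simp: add_divide_distrib[symmetric]\<close>)
  also have "\<dots> = 1" using pos by simp
  finally have "(\<Prod>i\<in>S. root ?k (a i / ?c i)) + (\<Prod>i\<in>S. root ?k (b i / ?c i)) \<le> 1" .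
  moreover have "0 \<le> (\<Prod>i\<in>S. root ?k (?c i))" using True pos by (auto intro!: prod_nonneg simp: less_imp_le)
  ultimately show ?thesis
    unfolding split[of a] split[of b] distrib_left[symmetric]
    by (rule mult_left_le)
next
  case False
  then obtain i where i: "i \<in> S" "a i = 0" "b i = 0" using ab by force
  then have "(\<Prod>j\<in>S. root (card S) (f j)) = 0" if "f i = 0" for f
    using S that i by (intro prod_zero bexI[of _ i]) auto
  then show ?thesis using i by simp
qed

section \<open>Weighted sums over subsets and Finner's inequality\<close>

lemma sum_Pow_insert:
  assumes "finite X" "x \<notin> X"
  shows "(\<Sum>A\<in>Pow (insert x X). f A) = (\<Sum>A\<in>Pow X. f A + f (insert x A))"
proof -
  have "(\<Sum>A\<in>Pow (insert x X). f A) = (\<Sum>A\<in>Pow X. f A) + (\<Sum>A\<in>insert x ` Pow X. f A)"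
    unfolding Pow_insert using assms by (intro sum.union_disjoint) auto
  also have "(\<Sum>A\<in>insert x ` Pow X. f A) = (\<Sum>A\<in>Pow X. f (insert x A))"
    using assms by (subst sum.reindex) (auto simp: inj_on_def)
  finally show ?thesis by (simp add: sum.distrib)
qed

text \<open>The weight is a product measure and \<open>g\<close> ignores the points of
  \<open>Y\<close>, so each of them factors out as \<open>1 + l\<close>: absent with weight 1 or
  present with weight \<open>l\<close>.\<close>

lemma sum_Pow_free_part:
  fixes l :: "'b::comm_semiring_1"
  assumes "finite X" "finite Y" "X \<inter> Y = {}"
  shows "(\<Sum>A\<in>Pow (X \<union> Y). l ^ card A * g (A \<inter> X))
           = (1 + l) ^ card Y * (\<Sum>A\<in>Pow X. l ^ card A * g A)"
  using assms(2,1,3)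
proof (induction Y rule: finite_induct)
  case empty
  then show ?case by (auto intro!: sum.cong simp: Int_absorb2)
next
  case (insert y Y)
  have "(\<Sum>A\<in>Pow (X \<union> insert y Y). l ^ card A * g (A \<inter> X))
          = (\<Sum>A\<in>Pow (X \<union> Y). l ^ card A * g (A \<inter> X) + l ^ card (insert y A) * g (insert y A \<inter> X))"
    using insert by (simp add: sum_Pow_insert)
  also have "\<dots> = (\<Sum>A\<in>Pow (X \<union> Y). (1 + l) * (l ^ card A * g (A \<inter> X)))"
  proof (rule sum.cong[OF refl])
    fix A assume "A \<in> Pow (X \<union> Y)"
    then have "finite A" "y \<notin> A" using insert by (auto intro: finite_subset)
    moreover have "insert y A \<inter> X = A \<inter> X" using insert by auto
    ultimately show "l ^ card A * g (A \<inter> X) + l ^ card (insert y A) * g (insert y A \<inter> X)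
        = (1 + l) * (l ^ card A * g (A \<inter> X))"
      by (simp add: algebra_simps)
  qed
  also have "\<dots> = (1 + l) ^ card (insert y Y) * (\<Sum>A\<in>Pow X. l ^ card A * g A)"
    using insert by (simp add: sum_distrib_left[symmetric] mult.assoc)
  finally show ?case .
qed

lemma sum_Pow_power_card:
  fixes l :: "'b::comm_semiring_1"
  assumes "finite Y"
  shows "(\<Sum>A\<in>Pow Y. l ^ card A) = (1 + l) ^ card Y"
  using sum_Pow_free_part[of "{}" Y l "\<lambda>_. 1"] assms by simp

text \<open>The \<open>F w\<close> are the \<open>k\<close>-th powers of the functions in Finner's inequality; each point carries
  the measure with weights \<open>1\<close> and \<open>l\<close> on its two states.\<close>

lemma finner_two_point:
  fixes F :: "'w \<Rightarrow> 'v set \<Rightarrow> real"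
  assumes "finite X" "finite W" "0 \<le> l" "0 < k"
    and "\<And>v. v \<in> X \<Longrightarrow> S v \<subseteq> W \<and> card (S v) = k"
    and "\<And>w B. 0 \<le> F w B"
  shows "(\<Sum>A\<in>Pow X. l ^ card A * (\<Prod>w\<in>W. root k (F w {v \<in> A. w \<in> S v})))
           \<le> (\<Prod>w\<in>W. root k (\<Sum>B\<in>Pow {v \<in> X. w \<in> S v}. l ^ card B * F w B))"
  using assms(1,5,6)
proof (induction X arbitrary: F rule: finite_induct)
  case empty
  then show ?case by simp
next
  case (insert x X)
  \<comment> \<open>\<open>F'\<close> integrates out the coordinate \<open>x\<close>: a function
    depending on \<open>x\<close> is summed over the two states of \<open>x\<close>, and the others
    stay as they are.\<close>
  define F' where "F' w B = (if w \<in> S x then F w B + l * F w (insert x B) else F w B)" for w B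
  have Sx: "S x \<subseteq> W" "card (S x) = k" using insert.prems(1) by auto
  then have fin: "finite (S x)" and ne: "S x \<noteq> {}"
    using \<open>0 < k\<close> \<open>finite W\<close> by (auto intro: finite_subset)
  have W: "(\<Prod>w\<in>W. f w) = (\<Prod>w\<in>S x. f w) * (\<Prod>w\<in>W - S x. f w)" for f :: "'w \<Rightarrow> real"
    using Sx \<open>finite W\<close> by (metis mult.commute prod.subset_diff)
  \<comment> \<open>Exactly \<open>k\<close> factors depend on \<open>x\<close>, so the weight
    \<open>l\<close>, written as the \<open>k\<close>-th power of \<open>root k l\<close>, is shared
    out with one root for each of them. Superadditivity then applies to these factors, while the
    remaining ones form the common factor \<open>?R\<close>.\<close>
  have step: "(\<Prod>w\<in>W. root k (F w {v \<in> A. w \<in> S v})) + l * (\<Prod>w\<in>W. root k (F w {v \<in> insert x A. w \<in> S v}))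
      \<le> (\<Prod>w\<in>W. root k (F' w {v \<in> A. w \<in> S v}))" (is "?a + l * ?b \<le> ?c") for A
  proof -
    let ?A = "\<lambda>w. {v \<in> A. w \<in> S v}"
    let ?R = "\<Prod>w\<in>W - S x. root k (F w (?A w))"
    have "(\<Prod>w\<in>S x. root k (l * F w (insert x (?A w))))
        = root k l ^ k * (\<Prod>w\<in>S x. root k (F w (insert x (?A w))))"
      by (simp add: real_root_mult prod.distrib Sx)
    also have "root k l ^ k = l" using \<open>0 \<le> l\<close> \<open>0 < k\<close> by simp
    finally have l: "l * (\<Prod>w\<in>S x. root k (F w (insert x (?A w))))
        = (\<Prod>w\<in>S x. root k (l * F w (insert x (?A w))))" by simp
    have "{v \<in> insert x A. w \<in> S v} = (if w \<in> S x then insert x (?A w) else ?A w)" for w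
      by auto
    then have "?b = (\<Prod>w\<in>S x. root k (F w (insert x (?A w)))) * ?R"
      unfolding W by simp
    then have "?a + l * ?b = ((\<Prod>w\<in>S x. root k (F w (?A w)))
        + (\<Prod>w\<in>S x. root k (l * F w (insert x (?A w))))) * ?R"
      unfolding l[symmetric] W by (simp add: algebra_simps)
    also have "\<dots> \<le> (\<Prod>w\<in>S x. root k (F w (?A w) + l * F w (insert x (?A w)))) * ?R"
      using prod_root_superadditive[OF fin ne, of "\<lambda>w. F w (?A w)" "\<lambda>w. l * F w (insert x (?A w))"]
        insert.prems(2) \<open>0 \<le> l\<close>
      by (intro mult_right_mono) (auto simp: Sx intro!: prod_nonneg real_root_ge_zero)
    also have "\<dots> = ?c"
      unfolding W by (simp add: F'_def)
    finally show ?thesis .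
  qed
  have "(\<Sum>A\<in>Pow (insert x X). l ^ card A * (\<Prod>w\<in>W. root k (F w {v \<in> A. w \<in> S v})))
      = (\<Sum>A\<in>Pow X. l ^ card A * (\<Prod>w\<in>W. root k (F w {v \<in> A. w \<in> S v}))
          + l ^ card (insert x A) * (\<Prod>w\<in>W. root k (F w {v \<in> insert x A. w \<in> S v})))"
    using insert.hyps by (rule sum_Pow_insert)
  also have "\<dots> \<le> (\<Sum>A\<in>Pow X. l ^ card A * (\<Prod>w\<in>W. root k (F' w {v \<in> A. w \<in> S v})))"
  proof (rule sum_mono)
    fix A assume "A \<in> Pow X"
    then have "card (insert x A) = Suc (card A)"
      using insert.hyps by (subst card_insert_disjoint) (auto intro: finite_subset)
    then show "l ^ card A * (\<Prod>w\<in>W. root k (F w {v \<in> A. w \<in> S v}))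
          + l ^ card (insert x A) * (\<Prod>w\<in>W. root k (F w {v \<in> insert x A. w \<in> S v}))
        \<le> l ^ card A * (\<Prod>w\<in>W. root k (F' w {v \<in> A. w \<in> S v}))"
      using mult_left_mono[OF step, of "l ^ card A" A] \<open>0 \<le> l\<close> by (simp add: algebra_simps)
  qed
  also have "\<dots> \<le> (\<Prod>w\<in>W. root k (\<Sum>B\<in>Pow {v \<in> X. w \<in> S v}. l ^ card B * F' w B))"
    by (rule insert.IH) (use insert.prems \<open>0 \<le> l\<close> in \<open>auto simp: F'_def\<close>)
  \<comment> \<open>For \<open>w\<close> in \<open>S x\<close>, sorting the subsets by whether they
    contain \<open>x\<close> reproduces the two summands of \<open>F'\<close>.\<close>
  also have "\<dots> = (\<Prod>w\<in>W. root k (\<Sum>B\<in>Pow {v \<in> insert x X. w \<in> S v}. l ^ card B * F w B))"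
  proof (intro prod.cong refl arg_cong[where f = "root k"])
    fix w assume "w \<in> W"
    let ?X = "{v \<in> X. w \<in> S v}"
    have fX: "finite ?X" "x \<notin> ?X" using insert.hyps by auto
    show "(\<Sum>B\<in>Pow ?X. l ^ card B * F' w B) = (\<Sum>B\<in>Pow {v \<in> insert x X. w \<in> S v}. l ^ card B * F w B)"
    proof (cases "w \<in> S x")
      case True
      then have "{v \<in> insert x X. w \<in> S v} = insert x ?X" by auto
      moreover have "card (insert x B) = Suc (card B)" if "B \<in> Pow ?X" for B
        using that fX by (subst card_insert_disjoint) (auto intro: finite_subset)
      ultimately show ?thesis
        by (simp only: sum_Pow_insert[OF fX]) (auto intro!: sum.cong simp: F'_def True algebra_simps)
    next
      case False
      then have "{v \<in> insert x X. w \<in> S v} = ?X" by auto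
      then show ?thesis by (simp add: F'_def False)
    qed
  qed
  finally show ?case .
qed

section \<open>Binomial coefficients and the mode of the binomial distribution\<close>

lemma binomial_ratio: "(real k + 1) * real (n choose Suc k) = real (n - k) * real (n choose k)"
proof -
  have "Suc k * (n choose Suc k) = (n - k) * (n choose k)"
    using binomial_absorption[of k n] binomial_absorb_comp[of n k] by simp
  then have "real (Suc k * (n choose Suc k)) = real ((n - k) * (n choose k))" by (simp only:)
  then show ?thesis by (simp only: of_nat_mult of_nat_Suc add.commute)
qed

text \<open>These are the binomial probabilities with success probability \<open>t / n\<close>,
  scaled by \<open>n ^ n\<close>. The step from \<open>k\<close> to \<open>k + 1\<close> multiplies
  by \<open>(n - k) t / ((k + 1) (n - t))\<close>, which is at least 1 iff
  \<open>(k + 1) n \<le> t (n + 1)\<close>. This holds for \<open>k < t\<close>, and the reverse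
  inequality holds for \<open>t \<le> k\<close>.\<close>

lemma binomial_distribution_mode:
  assumes "0 < t" "t < n" "k \<le> n"
  shows "(n choose k) * t ^ k * (n - t) ^ (n - k) \<le> (n choose t) * t ^ t * (n - t) ^ (n - t)"
proof -
  define a where "a k = real (n choose k) * real t ^ k * real (n - t) ^ (n - k)" for k
  have ratio: "(real k + 1) * real (n - t) * a (Suc k) = real (n - k) * real t * a k" if "k < n" for k
  proof -
    have *: "n - k = Suc (n - Suc k)" using that by simp
    have "(real k + 1) * real (n - t) * a (Suc k)
        = ((real k + 1) * real (n choose Suc k)) * (real t ^ Suc k * real (n - t) ^ (n - k))"
      unfolding a_def * by simp
    then show ?thesis unfolding binomial_ratio by (simp only: a_def power_Suc mult_ac)
  qed
  have nonneg: "0 \<le> a k" for k by (simp add: a_def)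
  have up: "a k \<le> a (Suc k)" if "k < t" for k
  proof -
    have "(real k + 1) * real (n - t) \<le> real (n - k) * real t"
    proof -
      have "(real k + 1) * real n \<le> real t * real n" using that by (intro mult_right_mono) auto
      then show ?thesis using that assms by (simp add: of_nat_diff algebra_simps)
    qed
    then have "(real k + 1) * real (n - t) * a k \<le> (real k + 1) * real (n - t) * a (Suc k)"
      using ratio[of k] that assms nonneg[of k] by (simp add: mult_right_mono)
    then show ?thesis using assms by (simp add: mult_le_cancel_left)
  qed
  have down: "a (Suc k) \<le> a k" if "t \<le> k" "k < n" for k
  proof -
    have "real (n - k) * real t \<le> (real k + 1) * real (n - t)"
    proof -
      have "real t * real n \<le> real k * real n" using that by (intro mult_right_mono) auto
      then have "real t * real n + real t \<le> real k * real n + real n"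
        using assms by linarith
      then show ?thesis using that assms by (simp add: of_nat_diff algebra_simps)
    qed
    then have "(real k + 1) * real (n - t) * a (Suc k) \<le> (real k + 1) * real (n - t) * a k"
      using ratio[of k] that assms nonneg[of k] by (simp add: mult_right_mono)
    then show ?thesis using assms by (simp add: mult_le_cancel_left)
  qed
  have "a k \<le> a t"
  proof (cases "k \<le> t")
    case True
    then show ?thesis by (induction k rule: inc_induct) (auto intro: order_trans[OF up])
  next
    case False
    then have "t \<le> k" by simp
    then show ?thesis using \<open>k \<le> n\<close>
      by (induction k rule: dec_induct) (auto intro: order_trans[OF down])
  qed
  then show ?thesis unfolding a_def of_nat_mult[symmetric] of_nat_power[symmetric] of_nat_le_iff .
qed

text \<open>The largest of the \<open>n + 1\<close> terms in the expansion of
  \<open>(t + (n - t)) ^ n\<close> is at least their average.\<close>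

lemma power_le_binomial:
  assumes "0 < t" "t < n"
  shows "n ^ n \<le> (n + 1) * (n choose t) * t ^ t * (n - t) ^ (n - t)"
proof -
  have "n ^ n = (t + (n - t)) ^ n" using assms by simp
  also have "\<dots> = (\<Sum>k\<le>n. (n choose k) * t ^ k * (n - t) ^ (n - k))"
    unfolding binomial_ring by simp
  also have "\<dots> \<le> (\<Sum>k\<le>n. (n choose t) * t ^ t * (n - t) ^ (n - t))"
    by (intro sum_mono binomial_distribution_mode assms) auto
  finally show ?thesis by (simp add: algebra_simps)
qed

lemma binomial_growth:
  fixes c :: real
  assumes "i \<le> j" "0 \<le> c"
    and "\<And>k. i \<le> k \<Longrightarrow> k < j \<Longrightarrow> c * (real k + 1) \<le> real n - real k"
  shows "c ^ (j - i) * real (n choose i) \<le> real (n choose j)"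
  using assms(1,3)
proof (induction j rule: dec_induct)
  case base
  then show ?case by simp
next
  case (step j)
  have j: "c * (real j + 1) \<le> real n - real j" using step by auto
  moreover have "0 \<le> c * (real j + 1)" using \<open>0 \<le> c\<close> by simp
  ultimately have "j \<le> n" by linarith
  have "(real j + 1) * (c ^ (Suc j - i) * real (n choose i))
      = c * (real j + 1) * (c ^ (j - i) * real (n choose i))"
    using step by (simp add: Suc_diff_le)
  also have "\<dots> \<le> (real n - real j) * real (n choose j)"
    using step j \<open>j \<le> n\<close> by (intro mult_mono) (auto simp: \<open>0 \<le> c\<close>)
  also have "\<dots> = (real j + 1) * real (n choose Suc j)"
    using \<open>j \<le> n\<close> by (simp only: binomial_ratio of_nat_diff)
  finally show ?case by (simp add: mult_le_cancel_left add_pos_nonneg)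
qed

lemma binomial_decay:
  fixes c :: real
  assumes "i \<le> j" "j \<le> n" "0 \<le> c"
    and "\<And>k. i \<le> k \<Longrightarrow> k < j \<Longrightarrow> c * (real n - real k) \<le> real k + 1"
  shows "c ^ (j - i) * real (n choose j) \<le> real (n choose i)"
proof -
  have "c ^ ((n - i) - (n - j)) * real (n choose (n - j)) \<le> real (n choose (n - i))"
  proof (rule binomial_growth)
    fix k assume k: "n - j \<le> k" "k < n - i"
    \<comment> \<open>Under the reflection of \<open>k\<close> to \<open>n - k\<close>, the step
      from \<open>k\<close> to \<open>k + 1\<close> becomes the one between \<open>n - k - 1\<close>
      and \<open>n - k\<close>, hence the shift by one.\<close>
    then have "c * (real n - real (n - k - 1)) \<le> real (n - k - 1) + 1"
      using assms by (intro assms(4)) linarith+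
    then show "c * (real k + 1) \<le> real n - real k"
      using k by (simp add: of_nat_diff algebra_simps)
  qed (use assms in auto)
  then show ?thesis using assms by (simp add: binomial_symmetric[symmetric])
qed

section \<open>Independent sets of bipartite graphs\<close>

lemma bipartition_sym:
  assumes "bipartition V E A B"
  shows "bipartition V E B A"
proof -
  have "\<exists>u\<in>B. \<exists>v\<in>A. e = {u, v}" if "e \<in> E" for e
    using assms that unfolding bipartition_def by (metis insert_commute)
  then show ?thesis using assms by (auto simp: bipartition_def)
qed

lemma card_neighbours:
  assumes "bipartition V E A B" "v \<in> A"
  shows "card {w \<in> B. {v, w} \<in> E} = deg E v"
proof -
  have "bij_betw (\<lambda>w. {v, w}) {w \<in> B. {v, w} \<in> E} {e \<in> E. v \<in> e}"
    unfolding bij_betw_def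
  proof (intro conjI subset_antisym subsetI)
    show "inj_on (\<lambda>w. {v, w}) {w \<in> B. {v, w} \<in> E}"
      by (auto simp: inj_on_def doubleton_eq_iff)
  next
    fix e assume "e \<in> {e \<in> E. v \<in> e}"
    then have e: "e \<in> E" "v \<in> e" by auto
    then obtain u w where uw: "u \<in> A" "w \<in> B" "e = {u, w}"
      using assms unfolding bipartition_def by blast
    then have "v = u" using assms e unfolding bipartition_def by blast
    then show "e \<in> (\<lambda>w. {v, w}) ` {w \<in> B. {v, w} \<in> E}" using uw e by blast
  qed auto
  then show ?thesis unfolding deg_def by (rule bij_betw_same_card)
qed

text \<open>No edge lies inside a class, so all \<open>t\<close>-subsets of \<open>B\<close> are
  independent.\<close>

lemma indep_count_ge_binomial:
  assumes "simple_graph V E" "bipartition V E A B"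
  shows "card B choose t \<le> indep_count V E t"
proof -
  have "B \<subseteq> V" "finite V" using assms by (auto simp: bipartition_def simple_graph_def)
  moreover have "indep I E" if "I \<subseteq> B" for I
    unfolding indep_def
  proof (intro ballI impI notI)
    fix v w assume "v \<in> I" "w \<in> I" "{v, w} \<in> E"
    then obtain u where "u \<in> A" "u \<in> {v, w}" using assms(2) unfolding bipartition_def by blast
    then show False using \<open>v \<in> I\<close> \<open>w \<in> I\<close> that assms(2) unfolding bipartition_def by auto
  qed
  ultimately have "card {I. I \<subseteq> B \<and> card I = t} \<le> indep_count V E t"
    unfolding indep_count_def by (intro card_mono) auto
  then show ?thesis using \<open>B \<subseteq> V\<close> \<open>finite V\<close> by (simp add: n_subsets finite_subset)
qed

text \<open>An independent set is determined by its traces \<open>X\<close> on \<open>A\<close> and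
  \<open>Y\<close> on \<open>B\<close>, and \<open>Y\<close> avoids all neighbours of
  \<open>X\<close>. Summing over every such pair, of any total size, gives an upper bound; for fixed
  \<open>X\<close> each vertex of \<open>B\<close> without a neighbour in \<open>X\<close>
  contributes a free factor \<open>1 + l\<close>.\<close>

lemma indep_count_power_le:
  fixes l :: real
  assumes "simple_graph V E" "bipartition V E A B" "0 \<le> l"
  shows "real (indep_count V E t) * l ^ t
           \<le> (\<Sum>X\<in>Pow A. l ^ card X * (\<Prod>w\<in>B. if \<exists>v\<in>X. {v, w} \<in> E then 1 else 1 + l))"
proof -
  let ?J = "{I. I \<subseteq> V \<and> indep I E \<and> card I = t}"
  let ?R = "\<lambda>X. {w \<in> B. \<not> (\<exists>v\<in>X. {v, w} \<in> E)}"
  let ?f = "\<lambda>I. (I \<inter> A, I \<inter> B)"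
  have fin: "finite V" "finite A" "finite B" and V: "A \<union> B = V" "A \<inter> B = {}"
    using assms(1,2) by (auto simp: simple_graph_def bipartition_def)
  have "real (indep_count V E t) * l ^ t = (\<Sum>I\<in>?J. l ^ card (fst (?f I)) * l ^ card (snd (?f I)))"
  proof -
    have "l ^ card (I \<inter> A) * l ^ card (I \<inter> B) = l ^ t" if "I \<in> ?J" for I
    proof -
      have "finite I" using that fin by (auto intro: finite_subset)
      then have "card (I \<inter> A \<union> I \<inter> B) = card (I \<inter> A) + card (I \<inter> B)"
        using V by (intro card_Un_disjoint) auto
      moreover have "I \<inter> A \<union> I \<inter> B = I" using that V by auto
      ultimately show ?thesis using that by (simp add: power_add[symmetric])
    qed
    then show ?thesis by (simp add: indep_count_def)
  qed
  also have "\<dots> = (\<Sum>p\<in>?f ` ?J. l ^ card (fst p) * l ^ card (snd p))"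
  proof (subst sum.reindex)
    show "inj_on ?f ?J" using V by (auto simp: inj_on_def)
  qed simp
  also have "\<dots> \<le> (\<Sum>p\<in>(SIGMA X:Pow A. Pow (?R X)). l ^ card (fst p) * l ^ card (snd p))"
  proof (rule sum_mono2)
    show "?f ` ?J \<subseteq> (SIGMA X:Pow A. Pow (?R X))"
      using V(2) by (force simp: indep_def)
  qed (use fin \<open>0 \<le> l\<close> in auto)
  also have "\<dots> = (\<Sum>X\<in>Pow A. l ^ card X * (\<Sum>Y\<in>Pow (?R X). l ^ card Y))"
    using fin by (simp add: sum_distrib_left sum.Sigma case_prod_unfold)
  also have "\<dots> = (\<Sum>X\<in>Pow A. l ^ card X * (\<Prod>w\<in>B. if \<exists>v\<in>X. {v, w} \<in> E then 1 else 1 + l))"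
    using fin by (simp add: sum_Pow_power_card prod.If_cases Int_def)
  finally show ?thesis .
qed

section \<open>Decoupling the vertices of one class\<close>

text \<open>\<open>S v\<close> lists the \<open>k\<close> edges kept at \<open>v\<close>. Vertices
  outside \<open>H\<close> keep no edge and factor out as free points; on \<open>H\<close> Finner's
  inequality replaces the joint sum by one sum for each \<open>w\<close>.\<close>

lemma partition_function_le:
  fixes A B :: "'a set" and l :: real
  assumes "finite A" "finite B" "0 \<le> l" "0 < k" "H \<subseteq> A"
    and S: "\<And>v. v \<in> H \<Longrightarrow> S v \<subseteq> {w \<in> B. {v, w} \<in> E} \<and> card (S v) = k"
  shows "(\<Sum>X\<in>Pow A. l ^ card X * (\<Prod>w\<in>B. if \<exists>v\<in>X. {v, w} \<in> E then 1 else 1 + l))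
           \<le> (1 + l) ^ card (A - H)
             * (\<Prod>w\<in>B. root k (2 * (1 + l) ^ max k (card {v \<in> H. w \<in> S v})))"
proof -
  \<comment> \<open>The \<open>k\<close>-th power of the local factor: its \<open>k\<close>-th root
    is \<open>1 + l\<close> if no chosen vertex blocks \<open>w\<close>, and 1 otherwise.\<close>
  define F where "F = (\<lambda>(w::'a) (X::'a set). if X = {} then (1 + l) ^ k else 1)"
  let ?T = "\<lambda>w X. {v \<in> X. w \<in> S v}"
  let ?g = "\<lambda>X. \<Prod>w\<in>B. root k (F w (?T w X))"
  have finH: "finite H" and A: "H \<union> (A - H) = A" using assms by (auto intro: finite_subset)
  have "(\<Sum>X\<in>Pow A. l ^ card X * (\<Prod>w\<in>B. if \<exists>v\<in>X. {v, w} \<in> E then 1 else 1 + l))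
      \<le> (\<Sum>X\<in>Pow A. l ^ card X * ?g (X \<inter> H))"
  \<comment> \<open>Deleting edges can only unblock \<open>w\<close>, so each local factor can only
    grow.\<close>
  proof (intro sum_mono mult_left_mono prod_mono conjI)
    fix X w assume "w \<in> B"
    have "\<exists>v\<in>X. {v, w} \<in> E" if "?T w (X \<inter> H) \<noteq> {}" using that S by auto
    then show "(if \<exists>v\<in>X. {v, w} \<in> E then 1 else 1 + l) \<le> root k (F w (?T w (X \<inter> H)))"
      using assms by (auto simp: F_def real_root_power_cancel)
  qed (use assms in auto)
  also have "\<dots> = (1 + l) ^ card (A - H) * (\<Sum>X\<in>Pow H. l ^ card X * ?g X)"
    using sum_Pow_free_part[of H "A - H" l ?g] finH assms(1) A by auto
  also have "\<dots> \<le> (1 + l) ^ card (A - H)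
      * (\<Prod>w\<in>B. root k (\<Sum>Y\<in>Pow (?T w H). l ^ card Y * F w Y))"
    using S assms finH by (intro mult_left_mono finner_two_point) (auto simp: F_def)
  also have "\<dots> \<le> (1 + l) ^ card (A - H) * (\<Prod>w\<in>B. root k (2 * (1 + l) ^ max k (card (?T w H))))"
  proof (intro mult_left_mono prod_mono conjI real_root_le_mono)
    fix w assume "w \<in> B"
    have finT: "finite (?T w H)" using finH by simp
    \<comment> \<open>Only the empty set has the large value \<open>(1 + l) ^ k\<close>; it is added
      to the full sum, and both resulting powers are raised to the larger exponent.\<close>
    have "(\<Sum>Y\<in>Pow (?T w H). l ^ card Y * F w Y)
        \<le> (\<Sum>Y\<in>Pow (?T w H). l ^ card Y + (if Y = {} then (1 + l) ^ k else 0))"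
      by (rule sum_mono) (use assms in \<open>auto simp: F_def\<close>)
    also have "\<dots> = (1 + l) ^ card (?T w H) + (1 + l) ^ k"
      using finT by (simp add: sum.distrib sum_Pow_power_card sum.delta)
    also have "\<dots> \<le> (1 + l) ^ max k (card (?T w H)) + (1 + l) ^ max k (card (?T w H))"
      using assms by (intro add_mono power_increasing) auto
    finally show "(\<Sum>Y\<in>Pow (?T w H). l ^ card Y * F w Y) \<le> 2 * (1 + l) ^ max k (card (?T w H))"
      by simp
  qed (use assms in \<open>auto intro!: real_root_ge_zero sum_nonneg simp: F_def\<close>)
  finally show ?thesis .
qed

lemma h_nonneg:
  assumes "0 < d" "card A \<le> card B"
  shows "0 \<le> h n E A B d"
proof -
  have "0 \<le> (\<Sum>v\<in>B. (real (deg E v) - d) * of_bool (d \<le> real (deg E v)))"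
    by (intro sum_nonneg) simp
  then show ?thesis unfolding h_def using assms by simp
qed

text \<open>The cost of a single vertex of degree \<open>D\<close> in the larger class, in terms
  that match \<open>h\<close>: the constant 2 costs at most \<open>1 / d\<close>, and the exponent
  \<open>max k m / k\<close> exceeds 1 only if \<open>m > k\<close>, when it is at most
  \<open>D / d\<close>.\<close>

lemma ln_root_two_power_le:
  fixes q d :: real
  assumes "1 \<le> q" "0 < d" "d \<le> real k" "m \<le> D"
  shows "ln (root k (2 * q ^ max k m))
           \<le> 1 / d + ln q * (1 + (real D - d) * of_bool (d \<le> real D) / d)"
proof -
  have k: "0 < k" using assms by (cases k) auto
  have "ln (root k (2 * q ^ max k m)) = ln 2 / k + ln q * (max k m / k)"
    using k assms by (simp add: ln_root ln_mult ln_realpow add_divide_distrib mult.commute)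
  also have "\<dots> \<le> 1 / d + ln q * (1 + (real D - d) * of_bool (d \<le> real D) / d)"
  proof (intro add_mono mult_left_mono frac_le)
    show "real (max k m) / real k \<le> 1 + (real D - d) * of_bool (d \<le> real D) / d"
    proof (cases "m \<le> k")
      case True
      then show ?thesis using k assms by (simp add: max_absorb1)
    next
      case False
      then have "d \<le> real D" using assms by linarith
      have "real m / real k \<le> real D / d" using assms by (intro frac_le) auto
      then show ?thesis using False \<open>d \<le> real D\<close> assms by (simp add: max_absorb2 diff_divide_distrib)
    qed
  qed (use assms ln_2_less_1 in auto)
  finally show ?thesis .
qed

lemma indep_count_power_le_exp:
  fixes l d :: real
  assumes G: "simple_graph V E" "bipartition V E A B" "card V = 2 * n" "card A \<le> card B" "1 \<le> n"
    and "0 \<le> l" "0 < d"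
  shows "real (indep_count V E t) * l ^ t
           \<le> (1 + l) ^ n * exp ((ln (1 + l) + 2) * (real n * h n E A B d))"
proof -
  \<comment> \<open>Hoelder's exponent must be an integer. Degrees are integers too, so degree at
    least \<open>d\<close> already means degree at least \<open>k\<close>.\<close>
  define k where "k = nat \<lceil>d\<rceil>"
  define H where "H = {v \<in> A. d \<le> real (deg E v)}"
  have k: "0 < k" "d \<le> real k" using \<open>0 < d\<close> by (auto simp: k_def)
  have fin: "finite V" "finite A" "finite B" and V: "A \<union> B = V" "A \<inter> B = {}"
    using G by (auto simp: simple_graph_def bipartition_def)
  have AB: "card A + card B = 2 * n" using V fin G(3) by (metis card_Un_disjoint)
  have "\<exists>T. T \<subseteq> {w \<in> B. {v, w} \<in> E} \<and> card T = k" if "v \<in> H" for v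
  proof -
    have "k \<le> card {w \<in> B. {v, w} \<in> E}"
      using that card_neighbours[OF G(2)] by (auto simp: H_def k_def nat_le_iff ceiling_le_iff)
    then show ?thesis by (rule obtain_subset_with_card_n) blast
  qed
  then obtain S where S: "\<And>v. v \<in> H \<Longrightarrow> S v \<subseteq> {w \<in> B. {v, w} \<in> E} \<and> card (S v) = k" by metis
  define m where "m w = card {v \<in> H. w \<in> S v}" for w
  define x where "x w = (real (deg E w) - d) * of_bool (d \<le> real (deg E w))" for w
  let ?q = "1 + l"
  have m_le: "m w \<le> deg E w" if "w \<in> B" for w
  proof -
    have "m w \<le> card {v \<in> A. {w, v} \<in> E}"
      unfolding m_def using S fin by (intro card_mono) (auto simp: H_def insert_commute)
    then show ?thesis using card_neighbours[OF bipartition_sym[OF G(2)] that] by simp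
  qed
  have root_le: "root k (2 * ?q ^ max k (m w)) \<le> exp (1 / d + ln ?q * (1 + x w / d))" if "w \<in> B" for w
  proof -
    have "0 < root k (2 * ?q ^ max k (m w))" using k \<open>0 \<le> l\<close> by simp
    moreover have "ln (root k (2 * ?q ^ max k (m w))) \<le> 1 / d + ln ?q * (1 + x w / d)"
      unfolding x_def by (rule ln_root_two_power_le) (use assms k m_le that in auto)
    ultimately show ?thesis by (metis exp_le_cancel_iff exp_ln)
  qed
  have "real (indep_count V E t) * l ^ t
      \<le> ?q ^ card (A - H) * (\<Prod>w\<in>B. root k (2 * ?q ^ max k (m w)))"
    unfolding m_def using fin k S \<open>0 \<le> l\<close>
    by (intro order_trans[OF indep_count_power_le[OF G(1,2) \<open>0 \<le> l\<close>]] partition_function_le)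
       (auto simp: H_def)
  also have "\<dots> \<le> ?q ^ card (A - H) * (\<Prod>w\<in>B. exp (1 / d + ln ?q * (1 + x w / d)))"
    using root_le \<open>0 \<le> l\<close> by (intro mult_left_mono prod_mono) (auto intro!: real_root_ge_zero)
  also have "\<dots> = exp (card (A - H) * ln ?q + (\<Sum>w\<in>B. 1 / d + ln ?q * (1 + x w / d)))"
    using fin \<open>0 \<le> l\<close> by (simp add: exp_sum exp_add exp_of_nat_mult)
  also have "(\<Sum>w\<in>B. 1 / d + ln ?q * (1 + x w / d))
      = card B / d + ln ?q * (card B + (\<Sum>w\<in>B. x w) / d)"
    by (simp add: sum.distrib sum_distrib_left[symmetric] sum_divide_distrib)
  \<comment> \<open>Since \<open>card B \<le> 2 * n\<close>, the terms \<open>1 / d\<close> sum to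
    at most twice \<open>n * h\<close>, which is the 2 in the constant. The coefficient of
    \<open>ln ?q\<close> exceeds \<open>n\<close> by at most the other three terms of
    \<open>n * h\<close>, as \<open>card B - n \<le> card B - card A\<close>.\<close>
  also have "card (A - H) * ln ?q + (card B / d + ln ?q * (card B + (\<Sum>w\<in>B. x w) / d))
      \<le> ln ?q * n + (ln ?q + 2) * (real n * h n E A B d)"
  proof -
    have "A - H = {v \<in> A. real (deg E v) < d}" by (auto simp: H_def)
    then have h: "real n * h n E A B d
        = n / d + card (A - H) + (\<Sum>w\<in>B. x w) / d + (real (card B) - real (card A))"
      using \<open>1 \<le> n\<close> \<open>0 < d\<close> unfolding h_def x_def by (simp add: field_simps)
    have x: "0 \<le> (\<Sum>w\<in>B. x w) / d"
      using \<open>0 < d\<close> by (auto intro!: sum_nonneg divide_nonneg_pos simp: x_def)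
    have AB': "real (card A) + real (card B) = 2 * real n" "real (card A) \<le> real (card B)"
      using AB G(4) by linarith+
    have "real (card B) / d \<le> 2 * (real n / d)"
      using AB' \<open>0 < d\<close> by (simp add: divide_right_mono)
    also have "\<dots> \<le> 2 * (real n * h n E A B d)"
      unfolding h using x AB' by simp
    finally have "card B / d \<le> 2 * (real n * h n E A B d)" .
    moreover have "ln ?q * (card (A - H) + card B + (\<Sum>w\<in>B. x w) / d)
        \<le> ln ?q * (n + real n * h n E A B d)"
    proof (rule mult_left_mono)
      have "0 \<le> n / d" using \<open>0 < d\<close> by simp
      then show "card (A - H) + card B + (\<Sum>w\<in>B. x w) / d \<le> n + real n * h n E A B d"
        unfolding h using AB' by linarith
    qed (use \<open>0 \<le> l\<close> in simp)
    ultimately show ?thesis by (simp add: algebra_simps)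
  qed
  finally show ?thesis using \<open>0 \<le> l\<close>
    by (simp add: exp_add exp_of_nat2_mult)
qed

section \<open>Comparison with binomial coefficients\<close>

lemma indep_count_le_binomial:
  fixes d :: real
  assumes G: "simple_graph V E" "bipartition V E A B" "card V = 2 * n" "card A \<le> card B" "1 \<le> n"
    and "0 < d" and t: "0 < t" "t < n"
  shows "real (indep_count V E t)
           \<le> (real n + 1) * real (n choose t) * exp ((ln (n / real (n - t)) + 2) * (real n * h n E A B d))"
proof -
  let ?i = "real (indep_count V E t)" and ?r = "real (n - t)"
  let ?e = "exp ((ln (n / real (n - t)) + 2) * (real n * h n E A B d))"
  have r: "0 < ?r" "?r + t = n" using t by auto
  have q: "1 + t / ?r = n / ?r" using r by (simp add: field_simps)
  \<comment> \<open>The choice \<open>l = t / (n - t)\<close> gives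
    \<open>1 + l = n / (n - t)\<close>. Clearing denominators leaves \<open>n ^ n\<close> against
    \<open>t ^ t * (n - t) ^ (n - t)\<close>, which \<open>power_le_binomial\<close>
    compares.\<close>
  have "?i * (t / ?r) ^ t \<le> (n / ?r) ^ n * ?e"
    using indep_count_power_le_exp[OF G, of "t / ?r" d t] \<open>0 < d\<close> unfolding q by simp
  then have "?i * (t / ?r) ^ t * ?r ^ n \<le> (n / ?r) ^ n * ?e * ?r ^ n"
    by (rule mult_right_mono) simp
  moreover have "(t / ?r) ^ t * ?r ^ n = real t ^ t * ?r ^ (n - t)"
    using r(1) t by (simp add: power_divide power_diff)
  moreover have "(n / ?r) ^ n * ?r ^ n = real n ^ n"
    using r(1) by (simp add: power_divide)
  moreover have "(n / ?r) ^ n * ?e * ?r ^ n = (n / ?r) ^ n * ?r ^ n * ?e" by (simp only: mult_ac)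
  ultimately have "?i * (real t ^ t * ?r ^ (n - t)) \<le> real n ^ n * ?e"
    by (simp only: mult.assoc)
  also have "\<dots> \<le> (real n + 1) * real (n choose t) * real t ^ t * ?r ^ (n - t) * ?e"
  proof (rule mult_right_mono)
    have "real (n ^ n) \<le> real ((n + 1) * (n choose t) * t ^ t * (n - t) ^ (n - t))"
      using power_le_binomial[OF t] by (simp only: of_nat_le_iff)
    then show "real n ^ n \<le> (real n + 1) * real (n choose t) * real t ^ t * ?r ^ (n - t)"
      by (simp only: of_nat_mult of_nat_add of_nat_1 of_nat_power)
  qed simp
  finally have "?i * (real t ^ t * ?r ^ (n - t))
      \<le> ((real n + 1) * real (n choose t) * ?e) * (real t ^ t * ?r ^ (n - t))"
    by (simp add: mult_ac)
  then show ?thesis by (rule mult_right_le_imp_le) (use r t in simp)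
qed

text \<open>After taking logarithms, \<open>ln (n + 1) \<le> 2 * ln n \<le> 2 * log 2 n\<close> for
  \<open>n \<ge> 2\<close>, so the polynomial factor costs at most twice the maximum and the
  exponential one at most \<open>K\<close> times it.\<close>

lemma error_factor_le_power:
  fixes K x \<epsilon> :: real
  assumes "0 < \<epsilon>" "0 \<le> K" "0 \<le> x" "2 \<le> n"
    and m: "2 * (K + 2) / ln (1 + \<epsilon>) * max (log 2 n) x \<le> real m"
  shows "(real n + 1) * exp (K * x) \<le> (1 + \<epsilon>) ^ m"
proof -
  let ?M = "max (log 2 n) x"
  have "ln (real n + 1) \<le> ln (real n ^ 2)"
  proof -
    have "real n + 1 \<le> real n * 2" using \<open>2 \<le> n\<close> by simp
    also have "\<dots> \<le> real n * real n" using \<open>2 \<le> n\<close> by (intro mult_left_mono) auto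
    finally show ?thesis using \<open>2 \<le> n\<close> by (simp add: power2_eq_square)
  qed
  also have "\<dots> = 2 * ln n" using \<open>2 \<le> n\<close> by (simp add: ln_realpow)
  also have "\<dots> \<le> 2 * log 2 n"
  proof -
    have "ln n * ln 2 \<le> ln n * 1" using \<open>2 \<le> n\<close> ln_2_less_1 by (intro mult_left_mono) auto
    then show ?thesis by (simp add: log_def field_simps)
  qed
  also have "\<dots> \<le> 2 * ?M" by simp
  finally have ln: "ln (real n + 1) \<le> 2 * ?M" .
  have "K * x \<le> K * ?M" using \<open>0 \<le> K\<close> by (intro mult_left_mono) auto
  moreover have "0 \<le> (K + 2) * ?M" using assms by (intro mult_nonneg_nonneg) auto
  ultimately have "ln (real n + 1) + K * x \<le> 2 * (K + 2) * ?M"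
    using ln by (simp add: algebra_simps)
  also have "\<dots> \<le> m * ln (1 + \<epsilon>)"
    using m \<open>0 < \<epsilon>\<close> by (simp add: field_simps)
  finally have "exp (ln (real n + 1) + K * x) \<le> exp (m * ln (1 + \<epsilon>))" by simp
  then show ?thesis using \<open>0 < \<epsilon>\<close> by (simp add: exp_add exp_of_nat_mult)
qed

text \<open>Meant for \<open>m = n / 2\<close> with \<open>u\<close>, \<open>v\<close> being
  \<open>k + 1\<close> and \<open>n - k\<close> in either order: it bounds the ratio of consecutive
  binomial coefficients away from the middle.\<close>

lemma ratio_ge_of_separated:
  fixes \<epsilon> u v m :: real
  assumes "0 < \<epsilon>" "\<epsilon> < 1" "0 \<le> m" "u \<le> (1 - \<epsilon>) * m" "(1 + \<epsilon>) * m \<le> v"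
  shows "(1 + \<epsilon>) * u \<le> v"
proof -
  have "(1 + \<epsilon>) * u \<le> (1 + \<epsilon>) * ((1 - \<epsilon>) * m)" using assms by (intro mult_left_mono) auto
  also have "\<dots> \<le> (1 + \<epsilon>) * m" using assms by (intro mult_left_mono) (auto simp: algebra_simps)
  also have "\<dots> \<le> v" by fact
  finally show ?thesis .
qed

theorem theorem1p7:
  fixes \<epsilon> :: real
  assumes "\<epsilon> > 0"
  shows "\<exists>C>0. \<forall>(n::nat) (V :: 'a set) (E :: 'a set set) \<E> \<O> (d::real).
           n \<ge> 1 \<and> simple_graph V E \<and> card V = 2 * n \<and>
           bipartition V E \<E> \<O> \<and> card \<E> \<le> card \<O> \<and> d > 0 \<longrightarrow>
           has_property n V E \<epsilon> \<epsilon> (C * max (log 2 (real n)) (real n * h n E \<E> \<O> d))"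
proof -
  \<comment> \<open>\<open>K\<close> bounds \<open>ln (1 + l) + 2\<close> over the whole range,
    because \<open>t \<le> (1 - \<epsilon>) * n\<close> gives
    \<open>1 + l = n / (n - t) \<le> 1 / \<epsilon>\<close>. \<open>C\<close> is the constant with
    which \<open>s\<close> steps of ratio \<open>1 + \<epsilon>\<close> absorb the error
    factor.\<close>
  define K where "K = \<bar>ln \<epsilon>\<bar> + 2"
  define C where "C = 2 * (K + 2) / ln (1 + \<epsilon>)"
  have K: "0 \<le> K" by (simp add: K_def)
  have "0 < C" unfolding C_def K_def using assms by (intro divide_pos_pos mult_pos_pos) auto
  moreover have "has_property n V E \<epsilon> \<epsilon> (C * max (log 2 (real n)) (real n * h n E \<E> \<O> d))"
    if "1 \<le> n" and G: "simple_graph V E" "bipartition V E \<E> \<O>" "card V = 2 * n" "card \<E> \<le> card \<O>"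
      and "0 < d" for n :: nat and V :: "'a set" and E \<E> \<O> and d :: real
  proof -
    define x where "x = real n * h n E \<E> \<O> d"
    have x: "0 \<le> x" using h_nonneg[OF \<open>0 < d\<close> G(4)] by (simp add: x_def)
    let ?i = "\<lambda>t. real (indep_count V E t)"
    have upper: "?i t \<le> (real n + 1) * exp (K * x) * real (n choose t)"
      if t: "\<epsilon> * n \<le> t" "t \<le> (1 - \<epsilon>) * n" for t :: nat
    proof -
      have "0 < \<epsilon> * n" using assms \<open>1 \<le> n\<close> by simp
      moreover have "real t \<le> n - \<epsilon> * n" using t by (simp add: algebra_simps)
      ultimately have tn: "0 < t" "t < n" and r: "\<epsilon> * n \<le> n - t" using t by linarith+
      have "ln (n / real (n - t)) \<le> ln (1 / \<epsilon>)"
        using r tn assms by (subst ln_le_cancel_iff) (auto simp: field_simps)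
      then have "ln (n / real (n - t)) + 2 \<le> K" using assms by (simp add: K_def ln_div)
      then have "exp ((ln (n / real (n - t)) + 2) * x) \<le> exp (K * x)"
        using x by (simp add: mult_right_mono)
      then have "(real n + 1) * real (n choose t) * exp ((ln (n / real (n - t)) + 2) * x)
          \<le> (real n + 1) * real (n choose t) * exp (K * x)"
        by (intro mult_left_mono) auto
      with indep_count_le_binomial[OF G \<open>1 \<le> n\<close> \<open>0 < d\<close> tn]
      have "?i t \<le> (real n + 1) * real (n choose t) * exp (K * x)"
        unfolding x_def by (rule order_trans)
      then show ?thesis by (simp add: mult_ac)
    qed
    \<comment> \<open>The larger class has at least \<open>n\<close> vertices.\<close>
    have lower: "real (n choose t) \<le> ?i t" for t
    proof -
      have "card \<E> + card \<O> = 2 * n"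
        using G by (metis bipartition_def card_Un_disjoint finite_Un simple_graph_def)
      then have "n choose t \<le> card \<O> choose t" using G(4) by (intro binomial_right_mono) simp
      then show ?thesis using indep_count_ge_binomial[OF G(1,2)] by (meson of_nat_le_iff order_trans)
    qed
    have error: "(real n + 1) * exp (K * x) \<le> (1 + \<epsilon>) ^ (j - i)"
      if "i \<le> j" "C * max (log 2 n) x \<le> real j - real i" "2 \<le> n" for i j
      by (rule error_factor_le_power) (use that assms K x in \<open>auto simp: C_def\<close>)
    \<comment> \<open>A nonempty range forces \<open>0 < i < n\<close>, hence
      \<open>n \<ge> 2\<close> and \<open>\<epsilon> < 1\<close>; otherwise the property is
      vacuous.\<close>
    have range: "2 \<le> n \<and> \<epsilon> < 1 \<and> \<epsilon> * n \<le> j \<and> i \<le> (1 - \<epsilon>) * n"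
      if "\<epsilon> * n \<le> i" "i \<le> j" "j \<le> (1 - \<epsilon>) * n" for i j :: nat
    proof -
      have "0 < \<epsilon> * n" using assms \<open>1 \<le> n\<close> by simp
      moreover have "real j \<le> n - \<epsilon> * n" using that by (simp add: algebra_simps)
      ultimately have "0 < i" "i < n" "\<epsilon> * n < 1 * real n" using that by linarith+
      then show ?thesis using that by (auto simp: mult_less_cancel_right)
    qed
    show ?thesis unfolding has_property_def step_increasing_on_def step_decreasing_on_def x_def[symmetric]
    proof (intro conjI allI impI; elim conjE)
      fix i j :: nat
      assume i: "\<epsilon> * n \<le> i" and ij: "i \<le> j" and j: "j \<le> (1 - \<epsilon>) * n / 2"
        and s: "C * max (log 2 n) x \<le> real j - real i"
      \<comment> \<open>The sign comes from \<open>j \<ge> 0\<close> and lets the halved upper bound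
        on \<open>j\<close> be relaxed.\<close>
      have "0 \<le> (1 - \<epsilon>) * n" using j by simp
      then have "j \<le> (1 - \<epsilon>) * n" using j by linarith
      with range[OF i ij] have R: "2 \<le> n" "\<epsilon> < 1" "i \<le> (1 - \<epsilon>) * n" by auto
      have "?i i \<le> (1 + \<epsilon>) ^ (j - i) * real (n choose i)"
        using upper[OF i R(3)] mult_right_mono[OF error[OF ij s R(1)], of "real (n choose i)"] by simp
      also have "\<dots> \<le> real (n choose j)"
      proof (rule binomial_growth[OF ij])
        fix k assume "k < j"
        then have k: "real k + 1 \<le> (1 - \<epsilon>) * (n / 2)" using j by simp
        then have "(1 + \<epsilon>) * (n / 2) \<le> real n - real k"
          unfolding distrib_right left_diff_distrib by linarith
        from ratio_ge_of_separated[OF assms R(2) _ k this]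
        show "(1 + \<epsilon>) * (real k + 1) \<le> real n - real k" by simp
      qed (use assms in simp)
      also have "\<dots> \<le> ?i j" by (rule lower)
      finally show "indep_count V E i \<le> indep_count V E j" by simp
    next
      fix i j :: nat
      assume i: "(1 + \<epsilon>) * n / 2 \<le> i" and ij: "i \<le> j" and j: "j \<le> (1 - \<epsilon>) * n"
        and s: "C * max (log 2 n) x \<le> real j - real i"
      have split: "(1 + \<epsilon>) * n = n + \<epsilon> * n" "(1 - \<epsilon>) * n = n - \<epsilon> * n"
        by (simp_all add: algebra_simps)
      \<comment> \<open>Subtracting \<open>i \<le> n - \<epsilon> * n\<close> from
        \<open>n + \<epsilon> * n \<le> 2 * i\<close> yields
        \<open>i \<ge> 2 * \<epsilon> * n\<close>.\<close>
      have "0 \<le> \<epsilon> * n" using assms by simp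
      moreover have "real n + \<epsilon> * n \<le> 2 * real i" using i unfolding split by simp
      moreover have "real i \<le> n - \<epsilon> * n" using ij j unfolding split by linarith
      ultimately have "\<epsilon> * n \<le> i" by linarith
      from range[OF this ij j] have R: "2 \<le> n" "\<epsilon> < 1" "\<epsilon> * n \<le> j" by auto
      have "?i j \<le> (1 + \<epsilon>) ^ (j - i) * real (n choose j)"
        using upper[OF R(3) j] mult_right_mono[OF error[OF ij s R(1)], of "real (n choose j)"] by simp
      also have "\<dots> \<le> real (n choose i)"
      proof (rule binomial_decay[OF ij])
        have "0 \<le> \<epsilon> * real n" using assms by simp
        then show "j \<le> n" using j by (simp add: algebra_simps)
        fix k assume "i \<le> k"
        then have k: "(1 + \<epsilon>) * (n / 2) \<le> real k + 1" using i by simp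
        have "real n - real k \<le> (1 - \<epsilon>) * (n / 2)"
          using i \<open>i \<le> k\<close> by (simp add: algebra_simps)
        from ratio_ge_of_separated[OF assms R(2) _ this k]
        show "(1 + \<epsilon>) * (real n - real k) \<le> real k + 1" by simp
      qed (use assms in simp)
      also have "\<dots> \<le> ?i i" by (rule lower)
      finally show "indep_count V E j \<le> indep_count V E i" by simp
    qed
  qed
  ultimately show ?thesis by blast
qed

end
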